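(* Let $n\ge 3$. Two directed trees $G$ and $H$ on the same vertex set, each with a single self-loop, located at its respective source, define the same $n$th-order cumulant ideal, $\mathcal{I}^{\le n}(G)=\mathcal{I}^{\le n}(H)$, if and only if (i) for all $\ell\ge 0$, the vertices at level $\ell$ in $G$ are the same as the vertices at level $\ell$ in $H$, i.e. $V_\ell(G)=V_\ell(H)$; and (ii) for each pair of vertices, the tops of the shortest equitreks between them are the same in $G$ and $H$.
   Context: A directed tree is a directed graph whose underlying undirected graph (ignoring self-loops) is a tree and which has exactly one source, i.e. exactly one vertex with no incoming edge from another vertex (a rooted tree with edges directed away from the root). Here the source carries a self-loop, and there are no other self-loops. Levels: the level of a vertex $v$ is the length (number of edges) of the shortest directed path from the source to $v$; $V_\ell(G)$ is the set of vertices of $G$ at level $\ell$. Equitreks: an equitrek between $i$ and $j$ is an ordered pair of directed paths (walks; vertices and edges, in particular the self-loop, may be repeated) of the same length $l\ge0$ from a common vertex $v$ (its top) to $i$ and to $j$, respectively; $l$ is its length. In a directed tree with a self-loop only at the source there is a unique shortest equitrek between any two vertices. Model and ideal: for a directed graph $G=(V,E)$ with $|V|=p$, $\mathbb{R}^E_{\mathrm{stab}}$ is the set of real $p\times p$ matrices $A=(a_{ji})$ with $a_{ji}=0$ whenever $i\to j\notin E$ and all complex eigenvalues of absolute value $<1$. The $n$th-order discrete Lyapunov cumulant model $\mathcal{M}_G^{\le n}$ is the set of tuples $(T_2,\dots,T_n)$ for which there are $A\in\mathbb{R}^E_{\mathrm{stab}}$ and diagonal tensors $\Omega^{(m)}\in\mathrm{Sym}_m(\mathbb{R}^p)$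 with $T_m=\sum_{i=0}^\infty\Omega^{(m)}\times_1A^i\times_2\cdots\times_mA^i$ for all $2\le m\le n$, where $\times_k$ denotes multiplication by a matrix along the $k$th mode, $(T\times_kA)_{\cdots j\cdots}=\sum_{i_k}T_{\cdots i_k\cdots}A_{ji_k}$. The $n$th-order cumulant ideal $\mathcal{I}^{\le n}(G)$ is the ideal of all real polynomials in the entries of the symmetric tensors $T_2,\dots,T_n$ (one variable per entry up to symmetry) that vanish on $\mathcal{M}_G^{\le n}$. *)

theory Defs
  imports
    "HOL-Analysis.Analysis"
    "HOL-Library.Multiset"
    "HOL-Library.Poly_Mapping"
    "Graph_Theory.Graph_Theory"
begin

section \<open>Directed trees with a loop at the source\<close>

abbreviation walk ::
  "'v pair_pre_digraph \<Rightarrow> 'v \<Rightarrow> ('v \<times> 'v) awalk \<Rightarrow> 'v \<Rightarrow> bool" where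
  "walk G \<equiv> pre_digraph.awalk (with_proj G)"

definition is_source :: "'v pair_pre_digraph \<Rightarrow> 'v \<Rightarrow> bool" where
  "is_source G v \<longleftrightarrow> v \<in> pverts G \<and> (\<forall>u. (u, v) \<in> parcs G \<longrightarrow> u = v)"

definition remove_loops :: "'v pair_pre_digraph \<Rightarrow> 'v pair_pre_digraph" where
  "remove_loops G = \<lparr> pverts = pverts G, parcs = {(u, v) \<in> parcs G. u \<noteq> v} \<rparr>"

text \<open>
  The constant \<open>tree\<close> of the graph library only forbids directed cycles and is therefore not
  the notion needed here. An undirected edge is represented by two opposite arcs, and a
  traversal of such a pair is a library \<open>cycle\<close> of length 2; hence the bound on the
  length. A pair of opposite arcs in \<^term>\<open>G\<close> itself gives two parallel undirected
  edges, that is, a cycle of the underlying undirected graph.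
\<close>

definition underlying_tree :: "'v pair_pre_digraph \<Rightarrow> bool" where
  "underlying_tree G \<longleftrightarrow>
     Digraph_Component.connected (with_proj (remove_loops G)) \<and>
     (\<forall>u v. (u, v) \<in> parcs G \<and> u \<noteq> v \<longrightarrow> (v, u) \<notin> parcs G) \<and>
     \<not> (\<exists>c. pre_digraph.cycle (with_proj (mk_symmetric (with_proj (remove_loops G)))) c \<and>
          length c \<ge> 3)"

definition directed_tree :: "'v pair_pre_digraph \<Rightarrow> bool" where
  "directed_tree G \<longleftrightarrow>
     pair_fin_digraph G \<and> underlying_tree G \<and> (\<exists>!s. is_source G s)"

definition source_looped_tree :: "'v pair_pre_digraph \<Rightarrow> bool" where
  "source_looped_tree G \<longleftrightarrow>
     directed_tree G \<and> (\<forall>v. (v, v) \<in> parcs G \<longleftrightarrow> is_source G v)"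

definition source :: "'v pair_pre_digraph \<Rightarrow> 'v" where
  "source G = (THE s. is_source G s)"

definition level :: "'v pair_pre_digraph \<Rightarrow> 'v \<Rightarrow> nat" where
  "level G v = (LEAST l. \<exists>p. walk G (source G) p v \<and> length p = l)"

definition level_set :: "'v pair_pre_digraph \<Rightarrow> nat \<Rightarrow> 'v set" where
  "level_set G l = {v \<in> pverts G. level G v = l}"

definition equitrek ::
  "'v pair_pre_digraph \<Rightarrow> 'v \<Rightarrow> 'v \<Rightarrow> 'v \<Rightarrow> ('v \<times> 'v) awalk \<times> ('v \<times> 'v) awalk \<Rightarrow> bool" where
  "equitrek G v i j = (\<lambda>(p, q). walk G v p i \<and> walk G v q j \<and> length p = length q)"

definition shortest_equitrek_tops :: "'v pair_pre_digraph \<Rightarrow> 'v \<Rightarrow> 'v \<Rightarrow> 'v set" where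
  "shortest_equitrek_tops G i j =
     {v. \<exists>p q. equitrek G v i j (p, q) \<and>
           (\<forall>w p' q'. equitrek G w i j (p', q') \<longrightarrow> length p \<le> length p')}"

section \<open>The discrete Lyapunov cumulant model\<close>

text \<open>
  A tensor of order \<open>m\<close> over \<open>\<real>\<^sup>V\<close> is a function on index lists, zero on lists of length
  other than \<open>m\<close>. Modes are numbered from 0.
\<close>

type_synonym 'v tensor = "'v list \<Rightarrow> real"

definition sym_tensors :: "nat \<Rightarrow> 'v tensor set" where
  "sym_tensors m = {T. (\<forall>js. length js \<noteq> m \<longrightarrow> T js = 0) \<and>
                       (\<forall>js ks. mset js = mset ks \<longrightarrow> T js = T ks)}"

definition diagonal :: "'v tensor \<Rightarrow> bool" where
  "diagonal T \<longleftrightarrow> (\<forall>js. T js \<noteq> 0 \<longrightarrow> (\<forall>i\<in>set js. \<forall>j\<in>set js. i = j))"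

definition mode_prod :: "'v::finite tensor \<Rightarrow> nat \<Rightarrow> real^'v^'v \<Rightarrow> 'v tensor" where
  "mode_prod T k A = (\<lambda>js. \<Sum>i\<in>UNIV. T (js[k := i]) * A $ (js ! k) $ i)"

definition all_modes_prod :: "nat \<Rightarrow> 'v::finite tensor \<Rightarrow> real^'v^'v \<Rightarrow> 'v tensor" where
  "all_modes_prod m T A = fold (\<lambda>k S. mode_prod S k A) [0..<m] T"

text \<open>The operator \<open>^\<close> on \<open>real^'v^'v\<close> would be the entrywise power.\<close>

definition matrix_power :: "real^'v^'v \<Rightarrow> nat \<Rightarrow> real^'v^'v" where
  "matrix_power A i = (((**) A) ^^ i) (mat 1)"

definition complex_eigenvalue :: "real^'v^'v \<Rightarrow> complex \<Rightarrow> bool" where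
  "complex_eigenvalue A c \<longleftrightarrow>
     (\<exists>x. x \<noteq> 0 \<and> map_matrix complex_of_real A *v x = c *s x)"

definition stable_matrices :: "'v::finite pair_pre_digraph \<Rightarrow> (real^'v^'v) set" where
  "stable_matrices G =
     {A. (\<forall>i j. (i, j) \<notin> parcs G \<longrightarrow> A $ j $ i = 0) \<and>
         (\<forall>c. complex_eigenvalue A c \<longrightarrow> norm c < 1)}"

definition cumulant_model :: "nat \<Rightarrow> 'v::finite pair_pre_digraph \<Rightarrow> (nat \<Rightarrow> 'v tensor) set" where
  "cumulant_model n G =
     {T \<in> (\<Pi>\<^sub>E m\<in>{2..n}. sym_tensors m).
        \<exists>A\<in>stable_matrices G. \<exists>\<Omega>. \<forall>m\<in>{2..n}.
          \<Omega> m \<in> sym_tensors m \<and> diagonal (\<Omega> m) \<and>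
          (\<forall>js. (\<lambda>i. all_modes_prod m (\<Omega> m) (matrix_power A i) js) sums T m js)}"

section \<open>The cumulant ideal\<close>

text \<open>
  Real polynomials in variables from \<open>'x\<close>, as finitely supported functions from
  monomials to coefficients; the ring structure is the one of \<open>Poly_Mapping\<close>. The entries
  of a symmetric tensor of order \<open>m\<close> are indexed by the multisets of size \<open>m\<close>.
\<close>

type_synonym 'x real_mpoly = "('x \<Rightarrow>\<^sub>0 nat) \<Rightarrow>\<^sub>0 real"

definition mpoly_vars :: "'x real_mpoly \<Rightarrow> 'x set" where
  "mpoly_vars f = (\<Union>mon\<in>Poly_Mapping.keys f. Poly_Mapping.keys mon)"

definition mpoly_eval :: "('x \<Rightarrow> real) \<Rightarrow> 'x real_mpoly \<Rightarrow> real" where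
  "mpoly_eval a f = (\<Sum>mon\<in>Poly_Mapping.keys f. Poly_Mapping.lookup f mon *
                       (\<Prod>x\<in>Poly_Mapping.keys mon. a x ^ Poly_Mapping.lookup mon x))"

definition sym_entry :: "(nat \<Rightarrow> 'v tensor) \<Rightarrow> 'v multiset \<Rightarrow> real" where
  "sym_entry T M = T (size M) (SOME js. mset js = M)"

definition cumulant_ideal :: "nat \<Rightarrow> 'v::finite pair_pre_digraph \<Rightarrow> 'v multiset real_mpoly set" where
  "cumulant_ideal n G =
     {f. mpoly_vars f \<subseteq> {M. size M \<in> {2..n}} \<and>
         (\<forall>T\<in>cumulant_model n G. mpoly_eval (sym_entry T) f = 0)}"

end

theory Submission
  imports Defs
begin

text \<open>
  The trees in question are the maps \<open>pa\<close> (parent, with \<open>pa r = r\<close> at the source) all of whose orbits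
  end in \<open>r\<close>. A walk of length \<open>t\<close> from \<open>u\<close> to \<open>v\<close> exists iff \<open>pa\<^sup>t v = u\<close>, so the top of the shortest
  equitrek is the point where the orbits of two vertices meet, and an entry of \<open>T\<^sub>m\<close> is the diagonal
  entry at the meeting point of its indices times a product of walk weights. If no edge weight
  vanishes, each edge weight is a quotient \<open>w j / w (pa j)\<close>; after rescaling the diagonal entries,
  only the loop weight \<open>\<rho>\<close>, the vertex weights \<open>w\<close> and free parameters \<open>s\<close> at the meeting points
  remain, and the tree enters through levels and meeting points alone. These generic points are
  dense in the model, hence determine the ideal.

  Conversely, explicit binomials in entries of order 2 and 3 recover the tree data: first the
  source, then the ratios of the levels (each \<open>\<rho> ^ lev i\<close> is a Laurent monomial in entries involving
  the source), and finally the meeting point of two vertices of the same level.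
\<close>

section \<open>Parent maps\<close>

locale parent_map =
  fixes pa :: "'v::finite \<Rightarrow> 'v" and r :: 'v
  assumes parent_root [simp]: "pa r = r"
    and reaches_root: "\<exists>t. (pa ^^ t) j = r"
begin

definition lev :: "'v \<Rightarrow> nat" where
  "lev j = (LEAST t. (pa ^^ t) j = r)"

text \<open>Stated for sets because an entry of order \<open>m\<close> depends on the joint ancestry
  of up to \<open>m\<close> distinct indices.\<close>

definition merged :: "nat \<Rightarrow> 'v set \<Rightarrow> bool" where
  "merged d S \<longleftrightarrow> (\<forall>i\<in>S. \<forall>j\<in>S. (pa ^^ d) i = (pa ^^ d) j)"

definition merge_time :: "'v set \<Rightarrow> nat" where
  "merge_time S = (LEAST d. merged d S)"

definition meet :: "'v set \<Rightarrow> 'v" where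
  "meet S = (pa ^^ merge_time S) (SOME j. j \<in> S)"

lemma funpow_root [simp]: "(pa ^^ t) r = r"
  by (induction t) auto

lemma funpow_split: "d \<le> d' \<Longrightarrow> (pa ^^ d') j = (pa ^^ (d' - d)) ((pa ^^ d) j)"
  using funpow_add[of "d' - d" d pa] by simp

lemma funpow_lev: "(pa ^^ lev j) j = r"
  unfolding lev_def using reaches_root by (rule LeastI_ex)

lemma funpow_eq_root_iff: "(pa ^^ t) j = r \<longleftrightarrow> lev j \<le> t"
proof
  assume "lev j \<le> t"
  then show "(pa ^^ t) j = r"
    using funpow_split[of "lev j" t j] by (simp add: funpow_lev)
qed (simp add: lev_def Least_le)

lemma lev_eq_0_iff [simp]: "lev j = 0 \<longleftrightarrow> j = r"
  using funpow_eq_root_iff[of 0 j] by auto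

lemma lev_root [simp]: "lev r = 0"
  by simp

text \<open>The subtraction truncates because an orbit stays at \<open>r\<close> once it gets there.
  Two naturals with the same upper bounds are equal; the same device serves for merge times
  below.\<close>

lemma lev_funpow: "lev ((pa ^^ t) j) = lev j - t"
proof -
  have "lev ((pa ^^ t) j) \<le> k \<longleftrightarrow> lev j - t \<le> k" for k
    using funpow_eq_root_iff[of k "(pa ^^ t) j"] funpow_eq_root_iff[of "k + t" j]
    by (simp add: funpow_add le_diff_conv)
  then show ?thesis
    by (meson le_antisym order_refl)
qed

lemma lev_parent: "lev (pa j) = lev j - 1"
  using lev_funpow[of 1 j] by simp

lemma lev_Suc: "j \<noteq> r \<Longrightarrow> lev j = Suc (lev (pa j))"
  by (metis One_nat_def Suc_pred lev_eq_0_iff lev_parent neq0_conv)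

lemma merged_mono: "merged d S \<Longrightarrow> d \<le> d' \<Longrightarrow> merged d' S"
  unfolding merged_def using funpow_split[of d d'] by metis

lemma ex_merged: "\<exists>d. merged d S"
proof -
  \<comment> \<open>The sum of all levels bounds each of them, so after that many steps every vertex
    has reached the root.\<close>
  have "merged (\<Sum>j\<in>UNIV. lev j) S"
    using member_le_sum[of _ UNIV lev] by (simp add: merged_def funpow_eq_root_iff[THEN iffD2])
  then show ?thesis ..
qed

lemma merged_iff: "merged d S \<longleftrightarrow> merge_time S \<le> d"
  unfolding merge_time_def
  using LeastI_ex[OF ex_merged] Least_le[of "\<lambda>d. merged d S" d] merged_mono by blast

lemma meet_eq: "j \<in> S \<Longrightarrow> (pa ^^ merge_time S) j = meet S"
  unfolding meet_def using merged_iff[of "merge_time S" S]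
  unfolding merged_def by (metis order_refl someI)

lemma merged_0: "merged 0 S \<longleftrightarrow> (\<forall>i\<in>S. \<forall>j\<in>S. i = j)"
  by (simp add: merged_def)

lemma merged_Suc: "merged (Suc d) S \<longleftrightarrow> merged d (pa ` S)"
  by (simp add: merged_def funpow_swap1)

text \<open>If the elements are not all equal, the first step up is unavoidable. This is the
  combinatorial form of the off-diagonal recursion satisfied by the cumulants.\<close>

lemma merge_time_parent:
  assumes "\<not> merged 0 S"
  shows "merge_time S = Suc (merge_time (pa ` S))"
proof -
  have "merge_time S \<le> k \<longleftrightarrow> Suc (merge_time (pa ` S)) \<le> k" for k
    using assms unfolding merged_iff[symmetric]
    by (cases k) (simp_all add: merged_Suc merged_iff[symmetric])
  then show ?thesis
    by (meson le_antisym order_refl)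
qed

lemma meet_parent:
  assumes "\<not> merged 0 S"
  shows "meet (pa ` S) = meet S"
proof -
  obtain j where "j \<in> S"
    using assms by (auto simp: merged_def)
  then show ?thesis
    using merge_time_parent[OF assms] meet_eq[of j S] meet_eq[of "pa j" "pa ` S"]
    by (simp add: funpow_swap1)
qed

lemma merge_time_singleton [simp]: "merge_time {j} = 0"
  using merged_iff[of 0 "{j}"] by (simp add: merged_0)

lemma meet_singleton [simp]: "meet {j} = j"
  using meet_eq[of j "{j}"] by simp

text \<open>Both vertices end at \<open>meet {i, j}\<close>; unless that is the root, this forces \<open>lev i = lev j\<close>.\<close>

lemma merge_time_pair:
  "merge_time {i, j} = max (lev i) (lev j) - lev (meet {i, j})"
proof -
  let ?d = "merge_time {i, j}" and ?v = "meet {i, j}"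
  have i: "(pa ^^ ?d) i = ?v" and j: "(pa ^^ ?d) j = ?v"
    by (auto intro: meet_eq)
  then have l: "lev ?v = lev i - ?d" "lev ?v = lev j - ?d"
    by (metis lev_funpow)+
  show ?thesis
  proof (cases "?v = r")
    case True
    then have "lev i \<le> ?d" "lev j \<le> ?d"
      using i j by (simp_all flip: funpow_eq_root_iff)
    moreover have "merged (max (lev i) (lev j)) {i, j}"
      by (simp add: merged_def funpow_eq_root_iff[THEN iffD2])
    ultimately show ?thesis
      using True by (simp add: merged_iff)
  next
    case False
    then have "lev ?v > 0"
      by (metis gr0I lev_eq_0_iff)
    then show ?thesis
      using l by linarith
  qed
qed

text \<open>Being merged is a condition on pairs, so the merge time of a set is governed by those of
  its pairs. This lets condition (ii), which speaks of pairs, control tensors of any order.\<close>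

lemma merge_time_le_iff_pairs: "merge_time S \<le> d \<longleftrightarrow> (\<forall>i\<in>S. \<forall>j\<in>S. merge_time {i, j} \<le> d)"
proof -
  have "merged d {i, j} \<longleftrightarrow> (pa ^^ d) i = (pa ^^ d) j" for i j
    by (auto simp: merged_def)
  then show ?thesis
    by (simp add: merged_def flip: merged_iff)
qed

lemma ex_merge_time_pair:
  assumes "S \<noteq> {}"
  shows "\<exists>i\<in>S. \<exists>j\<in>S. merge_time {i, j} = merge_time S"
proof (rule ccontr)
  assume *: "\<not> ?thesis"
  have le: "merge_time {i, j} \<le> merge_time S" if "i \<in> S" "j \<in> S" for i j
    using that merge_time_le_iff_pairs[of S "merge_time S"] by auto
  then have "merge_time {i, j} < merge_time S" if "i \<in> S" "j \<in> S" for i j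
    using * that by (metis le_neq_implies_less)
  then have "\<forall>i\<in>S. \<forall>j\<in>S. merge_time {i, j} \<le> merge_time S - 1"
    by fastforce
  \<comment> \<open>Truncated subtraction leaves the case of merge time 0, where any pair
    \<open>{i, i}\<close> attains it.\<close>
  then have "merge_time S \<le> merge_time S - 1"
    by (subst merge_time_le_iff_pairs)
  then have "merge_time S = 0"
    by simp
  then show False
    using * le assms by fastforce
qed

lemma merge_time_pair_same_level:
  assumes "lev i = lev j"
  shows "merge_time {i, j} \<le> lev i"
  by (simp add: assms merge_time_pair)

text \<open>Two different levels can agree after subtracting the same number only by truncation to
  0.\<close>

lemma meet_pair_different_level:
  assumes "lev i \<noteq> lev j"
  shows "meet {i, j} = r"
proof -
  have "lev (meet {i, j}) = lev i - merge_time {i, j}" "lev (meet {i, j}) = lev j - merge_time {i, j}"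
    by (metis insertI1 insertI2 lev_funpow meet_eq)+
  then show ?thesis
    using assms lev_eq_0_iff[of "meet {i, j}"] by linarith
qed

lemma merge_time_pair_root [simp]: "merge_time {i, r} = lev i"
proof -
  have "meet {i, r} = r"
    using meet_eq[of r "{i, r}"] by simp
  then show ?thesis
    by (simp add: merge_time_pair)
qed

lemma meet_pair_root [simp]: "meet {i, r} = r"
  using meet_eq[of r "{i, r}"] by simp

text \<open>Levels and pairwise meeting points give the pairwise merge times, hence all merge times.
  A pair that attains the merge time of \<open>S\<close> also has the same meeting point as
  \<open>S\<close>.\<close>

lemma merge_time_meet_cong:
  assumes "parent_map pa' r'"
    and lev: "\<And>j. lev j = parent_map.lev pa' r' j"
    and meet: "\<And>i j. meet {i, j} = parent_map.meet pa' {i, j}"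
    and "S \<noteq> {}"
  shows "merge_time S = parent_map.merge_time pa' S" "meet S = parent_map.meet pa' S"
proof -
  interpret P: parent_map pa' r' by fact
  have pair: "merge_time {i, j} = P.merge_time {i, j}" for i j
    by (simp add: merge_time_pair P.merge_time_pair lev meet)
  have "merge_time S \<le> d \<longleftrightarrow> P.merge_time S \<le> d" for d
    by (subst merge_time_le_iff_pairs, subst P.merge_time_le_iff_pairs) (simp add: pair)
  then show mt: "merge_time S = P.merge_time S"
    by (meson le_antisym order_refl)
  obtain i j where "i \<in> S" "j \<in> S" "merge_time {i, j} = merge_time S"
    using ex_merge_time_pair[OF \<open>S \<noteq> {}\<close>] by blast
  then show "meet S = P.meet S"
    using meet[of i j] meet_eq[of i S] meet_eq[of i "{i, j}"] P.meet_eq[of i S] P.meet_eq[of i "{i, j}"]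
      mt pair[of i j] by auto
qed

end

section \<open>Directed trees as parent maps\<close>

locale parent_graph = parent_map pa r for pa :: "'v::finite \<Rightarrow> 'v" and r +
  fixes G :: "'v pair_pre_digraph"
  assumes pverts_UNIV: "pverts G = UNIV"
    and arc_iff: "(i, j) \<in> parcs G \<longleftrightarrow> i = pa j"
    and source_eq: "source G = r"
begin

lemma walk_parent: "walk G u p v \<Longrightarrow> u = (pa ^^ length p) v"
proof (induction p arbitrary: u)
  case (Cons e p)
  then show ?case
    by (cases e) (auto simp: pre_digraph.awalk_def cas_with_proj_eq pverts_UNIV arc_iff)
qed (simp add: pre_digraph.awalk_def cas_with_proj_eq)

lemma ex_walk: "\<exists>p. walk G ((pa ^^ t) v) p v \<and> length p = t"
proof (induction t)
  case 0
  show ?case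
    by (rule exI[of _ "[]"]) (simp add: pre_digraph.awalk_def cas_with_proj_eq pverts_UNIV)
next
  case (Suc t)
  then obtain p where "walk G ((pa ^^ t) v) p v" "length p = t"
    by blast
  then show ?case
    by (intro exI[of _ "((pa ^^ Suc t) v, (pa ^^ t) v) # p"])
      (simp add: pre_digraph.awalk_def cas_with_proj_eq pverts_UNIV arc_iff)
qed

lemma ex_walk_iff: "(\<exists>p. walk G u p v \<and> length p = t) \<longleftrightarrow> (pa ^^ t) v = u"
  using walk_parent ex_walk by blast

lemma level_eq: "level G v = lev v"
  by (simp add: level_def lev_def ex_walk_iff source_eq)

lemma equitrek_parent:
  assumes "equitrek G v i j (p, q)"
  shows "(pa ^^ length p) i = v" "(pa ^^ length p) j = v" "merge_time {i, j} \<le> length p"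
proof -
  show i: "(pa ^^ length p) i = v" and j: "(pa ^^ length p) j = v"
    using assms walk_parent[of v p i] walk_parent[of v q j] by (auto simp: equitrek_def)
  show "merge_time {i, j} \<le> length p"
    by (simp add: i j merged_def flip: merged_iff)
qed

text \<open>Every equitrek is at least \<open>merge_time {i, j}\<close> long, the walks from the
  meeting point attain this length, and the length determines the top.\<close>

lemma shortest_equitrek_tops_eq: "shortest_equitrek_tops G i j = {meet {i, j}}"
proof -
  let ?d = "merge_time {i, j}"
  obtain p q where "walk G (meet {i, j}) p i" "length p = ?d" "walk G (meet {i, j}) q j" "length q = ?d"
    using ex_walk[of ?d i] ex_walk[of ?d j] by (auto simp: meet_eq)
  then have pq: "equitrek G (meet {i, j}) i j (p, q)" "length p = ?d"
    by (simp_all add: equitrek_def)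
  show ?thesis
  proof (intro set_eqI iffI)
    fix v assume "v \<in> shortest_equitrek_tops G i j"
    then obtain p' q' where v: "equitrek G v i j (p', q')" "length p' \<le> length p"
      using pq(1) unfolding shortest_equitrek_tops_def by blast
    then have "length p' = ?d"
      using equitrek_parent(3)[OF v(1)] pq(2) by simp
    then show "v \<in> {meet {i, j}}"
      using equitrek_parent(1)[OF v(1)] meet_eq[of i "{i, j}"] by simp
  next
    fix v assume "v \<in> {meet {i, j}}"
    then show "v \<in> shortest_equitrek_tops G i j"
      using pq equitrek_parent(3) unfolding shortest_equitrek_tops_def by auto
  qed
qed

end

section \<open>From the graph-theoretic definition of a tree to a unique parent map\<close>

lemma no_vertex_cycle:
  assumes tree: "underlying_tree G" and "pverts G = UNIV"
    and "length vs \<ge> 3" "distinct vs"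
    and adj: "\<And>i. Suc i < length vs \<Longrightarrow> (vs ! i, vs ! Suc i) \<in> parcs G \<or> (vs ! Suc i, vs ! i) \<in> parcs G"
    and closed: "(last vs, hd vs) \<in> parcs G \<or> (hd vs, last vs) \<in> parcs G"
  shows False
proof -
  let ?S = "mk_symmetric (with_proj (remove_loops G))"
  \<comment> \<open>With the closing arc first, the vertices visited after the start are exactly
    \<open>vs\<close>, so their distinctness is the one that \<open>cycle\<close> asks for.\<close>
  let ?c = "(last vs, hd vs) # zip vs (tl vs)"
  have arc: "(u, v) \<in> parcs ?S" if "(u, v) \<in> parcs G \<or> (v, u) \<in> parcs G" "u \<noteq> v" for u v
    using that by (force simp: parcs_mk_symmetric remove_loops_def)
  have cas: "pcas (hd ws) (zip ws (tl ws)) (last ws)" if "ws \<noteq> []" for ws :: "'a list"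
    using that
  proof (induction ws)
    case (Cons w ws)
    then show ?case by (cases ws) auto
  qed simp
  have verts: "pawalk_verts (hd ws) (zip ws (tl ws)) = ws" if "ws \<noteq> []" for ws :: "'a list"
    using that
  proof (induction ws)
    case (Cons w ws)
    then show ?case by (cases ws) auto
  qed simp
  have ne: "vs \<noteq> []" and ends: "last vs \<noteq> hd vs"
    using assms(3,4) by (cases vs; auto)+
  have "set (zip vs (tl vs)) \<subseteq> parcs ?S"
  proof
    fix e assume "e \<in> set (zip vs (tl vs))"
    then obtain i where "i < length (zip vs (tl vs))" "zip vs (tl vs) ! i = e"
      unfolding in_set_conv_nth by blast
    then have i: "Suc i < length vs" and e: "e = (vs ! i, vs ! Suc i)"
      by (auto simp: nth_tl)
    show "e \<in> parcs ?S"
      unfolding e using adj[OF i] \<open>distinct vs\<close> i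
      by (intro arc) (auto simp: nth_eq_iff_index_eq)
  qed
  then have "pre_digraph.awalk (with_proj ?S) (last vs) ?c (last vs)"
    using ne cas[OF ne] arc[OF closed] ends \<open>pverts G = UNIV\<close>
    by (simp add: pre_digraph.awalk_def cas_with_proj_eq remove_loops_def)
  moreover have "distinct (tl (pawalk_verts (last vs) ?c))"
    using verts[OF ne] \<open>distinct vs\<close> by simp
  ultimately have "pre_digraph.cycle (with_proj ?S) ?c"
    by (auto simp: pre_digraph.cycle_def awalk_verts_with_proj_eq)
  moreover have "length ?c \<ge> 3"
    using assms(3) by simp
  ultimately show False
    using tree by (auto simp: underlying_tree_def)
qed

text \<open>Choose one incoming arc per vertex: the loop at the source, an arc from another vertex
  elsewhere. A periodic orbit of this choice away from the source, or a second arc into some vertex,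
  would produce an undirected cycle or a pair of opposite arcs.\<close>

lemma source_looped_tree_parent_graph:
  fixes G :: "'v::finite pair_pre_digraph"
  assumes G: "source_looped_tree G" and UNIV: "pverts G = UNIV"
  shows "\<exists>pa r. parent_graph pa r G"
proof -
  have tree: "underlying_tree G" and ex1: "\<exists>!s. is_source G s"
    and loop: "\<And>v. (v, v) \<in> parcs G \<longleftrightarrow> is_source G v"
    using G by (auto simp: source_looped_tree_def directed_tree_def)
  have anti: "(v, u) \<notin> parcs G" if "(u, v) \<in> parcs G" "u \<noteq> v" for u v
    using that tree by (auto simp: underlying_tree_def)
  obtain r where r: "is_source G r" and r_unique: "\<And>s. is_source G s \<Longrightarrow> s = r"
    using ex1 by blast
  have "\<exists>u. (u, j) \<in> parcs G \<and> (u = j \<longleftrightarrow> j = r)" for j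
  proof (cases "j = r")
    case True
    then show ?thesis using loop r by auto
  next
    case False
    then show ?thesis using r_unique[of j] UNIV by (auto simp: is_source_def)
  qed
  then obtain pa where pa: "\<And>j. (pa j, j) \<in> parcs G" "\<And>j. pa j = j \<longleftrightarrow> j = r"
    by metis
  have adj: "((pa ^^ i) j, (pa ^^ Suc i) j) \<in> parcs G \<or> ((pa ^^ Suc i) j, (pa ^^ i) j) \<in> parcs G" for i j
    using pa by simp
  have pa_r: "(pa ^^ t) r = r" for t
    using pa(2)[of r] by (induction t) auto
  have periodic: "x = r" if "(pa ^^ k) x = x" "k > 0" for x k
  proof (rule ccontr)
    assume "x \<noteq> r"
    \<comment> \<open>The least period: 1 would make \<open>x\<close> a fixed point, 2 would give
      opposite arcs, and from 3 on the orbit itself is a cycle.\<close>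
    define a where "a = (LEAST a. (pa ^^ a) x = x \<and> a > 0)"
    have a: "(pa ^^ a) x = x" "a > 0"
      using LeastI[of "\<lambda>a. (pa ^^ a) x = x \<and> a > 0" k] that unfolding a_def by auto
    have least: "a \<le> b" if "(pa ^^ b) x = x" "b > 0" for b
      unfolding a_def using that by (intro Least_le) simp
    have "a \<noteq> 1"
      using a(1) pa(2)[of x] \<open>x \<noteq> r\<close> by auto
    moreover have "a \<noteq> 2"
      using a(1) pa(1)[of x] pa(1)[of "pa x"] anti[of "pa x" x] pa(2)[of x] \<open>x \<noteq> r\<close>
      by (auto simp: numeral_2_eq_2)
    ultimately have "a \<ge> 3"
      using a(2) by linarith
    let ?vs = "map (\<lambda>i. (pa ^^ i) x) [0..<a]"
    have neq: "(pa ^^ i) x \<noteq> (pa ^^ j) x" if "i < j" "j < a" for i j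
    proof
      assume "(pa ^^ i) x = (pa ^^ j) x"
      \<comment> \<open>Going on to the end of the period turns a repetition into the shorter period
        \<open>a - j + i\<close>.\<close>
      then have "(pa ^^ (a - j + i)) x = (pa ^^ (a - j + j)) x"
        by (simp only: funpow_add comp_apply)
      then have "(pa ^^ (a - j + i)) x = x"
        using a that by simp
      then show False
        using least[of "a - j + i"] that by simp
    qed
    have "distinct ?vs"
      using neq by (intro distinct_map[THEN iffD2] conjI distinct_upt linorder_inj_onI) auto
    moreover have "(last ?vs, hd ?vs) \<in> parcs G \<or> (hd ?vs, last ?vs) \<in> parcs G"
      using adj[of "a - 1" x] a \<open>a \<ge> 3\<close> by (simp add: last_map hd_map)
    ultimately show False
      using \<open>a \<ge> 3\<close> adj by (intro no_vertex_cycle[OF tree UNIV, of ?vs]) auto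
  qed
  have split: "(pa ^^ (j - i)) ((pa ^^ i) x) = (pa ^^ j) x" if "i < j" for i j x
    using that funpow_add[of "j - i" i pa] by simp
  have reach: "\<exists>t. (pa ^^ t) j = r" for j
  proof -
    \<comment> \<open>Pigeonhole: the orbit repeats a vertex, and a periodic vertex is the
      root.\<close>
    have "\<not> inj (\<lambda>t. (pa ^^ t) j)"
      using finite_imageD[of "\<lambda>t. (pa ^^ t) j" UNIV] by auto
    then obtain s t where "s < t" "(pa ^^ s) j = (pa ^^ t) j"
      unfolding inj_def by (metis nat_neq_iff)
    then have "(pa ^^ (t - s)) ((pa ^^ s) j) = (pa ^^ s) j"
      using split[of s t j] by simp
    then have "(pa ^^ s) j = r"
      using \<open>s < t\<close> by (intro periodic[of "t - s"]) auto
    then show ?thesis ..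
  qed
  have unique: "p = pa v" if "(p, v) \<in> parcs G" for p v
  proof (rule ccontr)
    assume "p \<noteq> pa v"
    have "v \<noteq> r"
      using that r pa(2)[of r] \<open>p \<noteq> pa v\<close> unfolding is_source_def by metis
    then have "p \<noteq> v"
      using that loop r_unique by blast
    \<comment> \<open>The orbits of \<open>p\<close> and \<open>v\<close> first meet after
      \<open>a\<close> and \<open>b\<close> steps. Up from \<open>p\<close>, down to
      \<open>v\<close> and back along the arc from \<open>p\<close> to \<open>v\<close> will be the
      forbidden cycle.\<close>
    define a where "a = (LEAST a. \<exists>b. (pa ^^ a) p = (pa ^^ b) v)"
    have "\<exists>a b. (pa ^^ a) p = (pa ^^ b) v"
      using reach[of p] reach[of v] by metis
    then have ex_b: "\<exists>b. (pa ^^ a) p = (pa ^^ b) v"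
      unfolding a_def by (rule LeastI_ex)
    have least_a: "a \<le> i" if "(pa ^^ i) p = (pa ^^ b) v" for i b
      unfolding a_def using that by (intro Least_le) blast
    define b where "b = (LEAST b. (pa ^^ a) p = (pa ^^ b) v)"
    have ab: "(pa ^^ a) p = (pa ^^ b) v"
      unfolding b_def using ex_b by (rule LeastI_ex)
    have least_b: "b \<le> i" if "(pa ^^ a) p = (pa ^^ i) v" for i
      unfolding b_def using that by (intro Least_le)
    have root_if_eq: "(pa ^^ i) x = r" if "(pa ^^ i) x = (pa ^^ j) x" "i < j" for i j x
    proof -
      have "(pa ^^ (j - i)) ((pa ^^ i) x) = (pa ^^ i) x"
        using that split[of i j x] by simp
      then show ?thesis
        using that(2) by (intro periodic[of "j - i"]) auto
    qed
    have neq_p: "(pa ^^ i) p \<noteq> (pa ^^ j) p" if "i < j" "j \<le> a" for i j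
    proof
      assume "(pa ^^ i) p = (pa ^^ j) p"
      then have "(pa ^^ i) p = r"
        using that by (intro root_if_eq) auto
      \<comment> \<open>The root also lies on the orbit of \<open>v\<close>, so the orbits would
        have met before step \<open>a\<close>.\<close>
      then show False
        using reach[of v] least_a[of i] that by (metis leD order_less_le_trans)
    qed
    have neq_v: "(pa ^^ i) v \<noteq> (pa ^^ j) v" if "i < j" "j \<le> b" for i j
    proof
      assume "(pa ^^ i) v = (pa ^^ j) v"
      then have "(pa ^^ i) v = r"
        using that by (intro root_if_eq) auto
      then have "(pa ^^ a) p = (pa ^^ i) v"
        using ab pa_r split[of i b v] that by simp
      then show False
        using least_b[of i] that by auto
    qed
    have neq_pv: "(pa ^^ i) p \<noteq> (pa ^^ j) v" if "i \<le> a" "j < b" for i j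
    proof
      assume eq: "(pa ^^ i) p = (pa ^^ j) v"
      then have "i = a"
        using least_a that by (simp add: le_antisym)
      then show False
        using least_b[of j] eq that by simp
    qed
    define f where "f i = (if i \<le> a then (pa ^^ i) p else (pa ^^ (a + b - i)) v)" for i
    let ?vs = "map f [0..<Suc (a + b)]"
    \<comment> \<open>The degenerate cases are \<open>p = v\<close>, \<open>pa p = v\<close>
      (opposite arcs) and \<open>p = pa v\<close>; without them the cycle has at least three
      vertices.\<close>
    have "a + b \<noteq> 0"
      using ab \<open>p \<noteq> v\<close> by (intro notI) simp
    moreover have "\<not> (a = 1 \<and> b = 0)"
      using ab pa(1)[of p] anti[OF that \<open>p \<noteq> v\<close>] by (intro notI) simp
    moreover have "\<not> (a = 0 \<and> b = 1)"
      using ab \<open>p \<noteq> pa v\<close> by (intro notI) simp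
    ultimately have "a + b \<ge> 2"
      by linarith
    have "f i \<noteq> f j" if "i < j" "j \<le> a + b" for i j
      using that neq_p[of i j] neq_v[of "a + b - j" "a + b - i"] neq_pv[of i "a + b - j"]
      by (auto simp: f_def eq_commute)
    then have "distinct ?vs"
      by (intro distinct_map[THEN iffD2] conjI distinct_upt linorder_inj_onI) (auto simp del: upt_Suc)
    moreover have "last ?vs = v"
      using ab by (auto simp: last_map f_def)
    moreover have "hd ?vs = p"
      by (simp add: hd_map f_def del: upt_Suc)
    moreover have "(f i, f (Suc i)) \<in> parcs G \<or> (f (Suc i), f i) \<in> parcs G" if "i < a + b" for i
    proof (cases i a rule: linorder_cases)
      case less
      then show ?thesis using adj[of i p] by (simp add: f_def)
    next
      case equal
      then have "f i = (pa ^^ Suc (b - 1)) v" "f (Suc i) = (pa ^^ (b - 1)) v"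
        using that ab by (auto simp: f_def)
      then show ?thesis using adj[of "b - 1" v] by auto
    next
      case greater
      then have "a + b - i = Suc (a + b - Suc i)"
        using that by simp
      then show ?thesis using adj[of "a + b - Suc i" v] greater by (auto simp: f_def)
    qed
    ultimately show False
      using \<open>a + b \<ge> 2\<close> that
      by (intro no_vertex_cycle[OF tree UNIV, of ?vs]) (simp_all add: nth_append del: upt_Suc)
  qed
  have "source G = r"
    unfolding source_def using r r_unique by (rule the_equality)
  then have "parent_graph pa r G"
    using reach pa unique UNIV by unfold_locales auto
  then show ?thesis
    by blast
qed

section \<open>Parametrization of the model\<close>

context parent_map
begin

text \<open>Here \<open>a j\<close> is the weight of the arc from \<open>pa j\<close> to
  \<open>j\<close>, so \<open>a r\<close> is the loop weight.\<close>

primrec path_weight :: "('v \<Rightarrow> real) \<Rightarrow> nat \<Rightarrow> 'v \<Rightarrow> real" where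
  "path_weight a 0 j = 1"
| "path_weight a (Suc t) j = a j * path_weight a t (pa j)"

text \<open>Splits off the topmost arc, whereas the definition splits off the lowest. The former
  makes the series telescope, the latter gives the off-diagonal recursion.\<close>

lemma path_weight_Suc': "path_weight a (Suc t) j = path_weight a t j * a ((pa ^^ t) j)"
proof (induction t arbitrary: j)
  case (Suc t)
  show ?case
    by (subst path_weight.simps(2), subst Suc) (simp add: funpow_swap1)
qed simp

lemma path_weight_beyond_root:
  "path_weight a (t + lev j) j = path_weight a (lev j) j * a r ^ t"
  by (induction t) (simp_all add: path_weight_Suc' funpow_eq_root_iff[THEN iffD2] del: path_weight.simps(2))

lemma path_weight_tendsto_0:
  assumes "\<bar>a r\<bar> < 1"
  shows "(\<lambda>t. path_weight a t j) \<longlonglongrightarrow> 0"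
proof (rule LIMSEQ_offset[of _ "lev j"])
  have "(\<lambda>t. path_weight a (lev j) j * a r ^ t) \<longlonglongrightarrow> path_weight a (lev j) j * 0"
    by (intro tendsto_intros LIMSEQ_power_zero) (use assms in simp)
  then show "(\<lambda>t. path_weight a (t + lev j) j) \<longlonglongrightarrow> 0"
    by (simp add: path_weight_beyond_root)
qed

definition parent_matrix :: "('v \<Rightarrow> real) \<Rightarrow> real^'v^'v" where
  "parent_matrix a = (\<chi> j i. if i = pa j then a j else 0)"

lemma parent_matrix_nth [simp]: "parent_matrix a $ j $ i = (if i = pa j then a j else 0)"
  by (simp add: parent_matrix_def)

lemma matrix_power_parent:
  "matrix_power (parent_matrix a) t $ j $ k = (if k = (pa ^^ t) j then path_weight a t j else 0)"
proof (induction t arbitrary: j)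
  case 0
  show ?case by (simp add: matrix_power_def mat_def)
next
  case (Suc t)
  have "matrix_power (parent_matrix a) (Suc t) = parent_matrix a ** matrix_power (parent_matrix a) t"
    by (simp add: matrix_power_def)
  then have "matrix_power (parent_matrix a) (Suc t) $ j $ k =
      (\<Sum>l\<in>UNIV. if l = pa j then a j * matrix_power (parent_matrix a) t $ l $ k else 0)"
    by (simp add: matrix_matrix_mult_def if_distrib[of "\<lambda>x. x * _"] cong: if_cong)
  also have "\<dots> = a j * matrix_power (parent_matrix a) t $ pa j $ k"
    by simp
  finally show ?case
    by (simp add: Suc funpow_swap1)
qed

section \<open>Spectrum of a parent matrix\<close>

lemma parent_matrix_eigen_iff:
  "map_matrix complex_of_real (parent_matrix a) *v x = c *s x \<longleftrightarrow>
    (\<forall>j. complex_of_real (a j) * x $ pa j = c * x $ j)"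
proof -
  have "(map_matrix complex_of_real (parent_matrix a) *v x) $ j = complex_of_real (a j) * x $ pa j" for j
  proof -
    have "(map_matrix complex_of_real (parent_matrix a) *v x) $ j =
        (\<Sum>l\<in>UNIV. if l = pa j then complex_of_real (a j) * x $ l else 0)"
      unfolding matrix_vector_mult_def vec_lambda_beta by (rule sum.cong) (auto simp: map_matrix_def)
    then show ?thesis
      by simp
  qed
  then show ?thesis
    by (simp add: vec_eq_iff)
qed

text \<open>Reading the eigenvector equation at the root gives \<open>c = a r\<close> if
  \<open>x $ r\<close> is nonzero. Otherwise following it up to the root gives
  \<open>c ^ lev j * x $ j = 0\<close> for all \<open>j\<close>, so \<open>c = 0\<close>.\<close>

lemma eigenvalue_norm_less_1:
  assumes "\<bar>a r\<bar> < 1" and "complex_eigenvalue (parent_matrix a) c"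
  shows "norm c < 1"
proof -
  obtain x where "x \<noteq> 0" and x: "\<And>j. complex_of_real (a j) * x $ pa j = c * x $ j"
    using assms(2) unfolding complex_eigenvalue_def parent_matrix_eigen_iff by blast
  show ?thesis
  proof (cases "x $ r = 0")
    case True
    have "c ^ t * x $ j = complex_of_real (path_weight a t j) * x $ ((pa ^^ t) j)" for t j
    proof (induction t arbitrary: j)
      case (Suc t)
      have "c ^ Suc t * x $ j = complex_of_real (a j) * (c ^ t * x $ pa j)"
        using x[of j] by (simp add: mult_ac)
      then show ?case
        by (simp only: Suc) (simp add: funpow_swap1 mult.assoc)
    qed simp
    then have *: "c ^ lev j * x $ j = 0" for j
      by (simp add: funpow_lev True)
    obtain j where "x $ j \<noteq> 0"
      using \<open>x \<noteq> 0\<close> by (auto simp: vec_eq_iff)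
    then show ?thesis
      using *[of j] by auto
  next
    case False
    then have "c = complex_of_real (a r)"
      using x[of r] by simp
    then show ?thesis
      using assms(1) by simp
  qed
qed

text \<open>The converse bound: stability forces \<open>\<bar>a r\<bar> < 1\<close>. The eigenvector
  is found by solving the equation downwards from the value 1 at the root.\<close>

lemma root_weight_eigenvalue:
  assumes "a r \<noteq> 0"
  shows "complex_eigenvalue (parent_matrix a) (complex_of_real (a r))"
proof -
  define x :: "complex^'v" where "x = (\<chi> j. complex_of_real (path_weight a (lev j) j / a r ^ lev j))"
  have "complex_of_real (a j) * x $ pa j = complex_of_real (a r) * x $ j" for j
  proof (cases "j = r")
    case False
    then obtain l where "lev j = Suc l"
      by (metis lev_eq_0_iff not0_implies_Suc)
    then show ?thesis
      using assms by (simp add: x_def lev_parent)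
  qed simp
  moreover have "x $ r = 1"
    by (simp add: x_def)
  then have "x \<noteq> 0"
    by auto
  ultimately show ?thesis
    unfolding complex_eigenvalue_def parent_matrix_eigen_iff by blast
qed

text \<open>The free parameters \<open>t m k\<close> are the diagonal entries of the cumulant
  itself, not those of the noise tensor.\<close>

definition cumulant :: "('v \<Rightarrow> real) \<Rightarrow> (nat \<Rightarrow> 'v \<Rightarrow> real) \<Rightarrow> nat \<Rightarrow> 'v tensor" where
  "cumulant a t m js =
     (if length js = m
      then t m (meet (set js)) * prod_list (map (path_weight a (merge_time (set js))) js) else 0)"

end

section \<open>Contraction of all modes and summation of the Lyapunov series\<close>

lemma prod_list_map_mset: "prod_list (map f xs) = (\<Prod>x\<in>#mset xs. f x :: real)"
  by (metis mset_map prod_mset_prod_list)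

text \<open>With one possibly nonzero entry per row, the sum in each mode has a single term, so
  contraction is substitution of an index.\<close>

lemma all_modes_prod_single_entry_rows:
  assumes B: "\<And>j k. B $ j $ k = (if k = g j then c j else 0)"
  shows "all_modes_prod (length js) T B js = T (map g js) * prod_list (map c js)"
proof -
  have mode: "mode_prod S k B ks = S (ks[k := g (ks ! k)]) * c (ks ! k)" for S k ks
  proof -
    have "mode_prod S k B ks = (\<Sum>i\<in>UNIV. if i = g (ks ! k) then S (ks[k := i]) * c (ks ! k) else 0)"
      unfolding mode_prod_def B by (rule sum.cong) auto
    then show ?thesis
      by simp
  qed
  have "fold (\<lambda>k S. mode_prod S k B) [0..<q] T ks =
      T (map g (take q ks) @ drop q ks) * prod_list (map c (take q ks))" if "q \<le> length ks" for q ks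
    using that
  proof (induction q arbitrary: ks)
    case (Suc q)
    then show ?case
      by (simp add: mode take_Suc_conv_app_nth drop_update_cancel Cons_nth_drop_Suc[symmetric]
          upd_conv_take_nth_drop mult_ac)
  qed simp
  then show ?thesis
    by (simp add: all_modes_prod_def)
qed

lemma all_modes_prod_wrong_length:
  assumes "\<And>js. length js \<noteq> m \<Longrightarrow> T js = 0" and "length js \<noteq> m"
  shows "all_modes_prod m T B js = 0"
proof -
  have "\<forall>ks. length ks \<noteq> m \<longrightarrow> fold (\<lambda>k S. mode_prod S k B) xs T ks = 0" for xs
    using assms(1)
  proof (induction xs arbitrary: T)
    case (Cons k xs)
    show ?case
      unfolding fold_Cons comp_apply
      by (rule Cons.IH) (simp add: mode_prod_def Cons.prems)
  qed simp
  then show ?thesis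
    using assms(2) by (simp add: all_modes_prod_def)
qed

context parent_map
begin

lemma prod_list_path_weight_Suc:
  "prod_list (map (path_weight a (Suc t)) js) =
     prod_list (map a js) * prod_list (map (path_weight a t) (map pa js))"
  by (induction js) simp_all

lemma prod_list_path_weight_Suc':
  "prod_list (map (path_weight a (Suc t)) js) =
     prod_list (map (path_weight a t) js) * prod_list (map a (map (pa ^^ t) js))"
  by (induction js) (simp_all add: path_weight_Suc' del: path_weight.simps)

lemma all_modes_prod_parent:
  "length js = m \<Longrightarrow> all_modes_prod m T (matrix_power (parent_matrix a) i) js =
     T (map (pa ^^ i) js) * prod_list (map (path_weight a i) js)"
  using all_modes_prod_single_entry_rows[OF matrix_power_parent] by blast

lemma cumulant_sym: "cumulant a t m \<in> sym_tensors m"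
proof -
  have "cumulant a t m js = cumulant a t m ks" if "mset js = mset ks" for js ks
    using that mset_eq_setD[OF that] mset_eq_length[OF that]
    by (simp add: cumulant_def prod_list_map_mset)
  moreover have "\<forall>js. length js \<noteq> m \<longrightarrow> cumulant a t m js = 0"
    by (simp add: cumulant_def)
  ultimately show ?thesis
    unfolding sym_tensors_def by blast
qed

lemma cumulant_parent:
  assumes "\<not> merged 0 (set js)" "length js = m"
  shows "cumulant a t m js = prod_list (map a js) * cumulant a t m (map pa js)"
proof -
  have "prod_list (map (path_weight a (merge_time (set js))) js) =
      prod_list (map a js) * prod_list (map (path_weight a (merge_time (set (map pa js)))) (map pa js))"
    by (simp only: merge_time_parent[OF assms(1)] prod_list_path_weight_Suc set_map)
  then show ?thesis
    unfolding cumulant_def using assms(2) by (simp add: meet_parent[OF assms(1)])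
qed

text \<open>Any prescribed diagonal entries \<open>t\<close> occur: the noise tensor is obtained by
  solving the Lyapunov equation for it, and it is diagonal by
  \<open>cumulant_parent\<close>.\<close>

lemma lyapunov_sums_cumulant:
  assumes "\<bar>a r\<bar> < 1" and "m > 0"
  shows "\<exists>\<Omega>. \<Omega> \<in> sym_tensors m \<and> diagonal \<Omega> \<and>
    (\<forall>js. (\<lambda>i. all_modes_prod m \<Omega> (matrix_power (parent_matrix a) i) js) sums cumulant a t m js)"
proof -
  let ?C = "cumulant a t m"
  define \<Omega> where "\<Omega> js = ?C js - (if length js = m then prod_list (map a js) * ?C (map pa js) else 0)"
    for js
  have len: "\<Omega> js = 0" if "length js \<noteq> m" for js
    using that by (simp add: \<Omega>_def cumulant_def)
  moreover have "\<Omega> js = \<Omega> ks" if "mset js = mset ks" for js ks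
  proof -
    have C: "?C us = ?C vs" if "mset us = mset vs" for us vs
      using cumulant_sym[of a t m] that unfolding sym_tensors_def by blast
    have "?C (map pa js) = ?C (map pa ks)"
      by (intro C) (simp add: that)
    then show ?thesis
      by (simp only: \<Omega>_def C[OF that] prod_list_map_mset that mset_eq_length[OF that])
  qed
  ultimately have "\<Omega> \<in> sym_tensors m"
    unfolding sym_tensors_def by blast
  moreover have "\<Omega> js = 0" if "\<not> merged 0 (set js)" for js
  proof (cases "length js = m")
    case True
    have "?C js = prod_list (map a js) * ?C (map pa js)"
      using that True by (rule cumulant_parent)
    then show ?thesis
      by (simp only: \<Omega>_def True refl if_True diff_self)
  qed (rule len)
  then have "diagonal \<Omega>"
    unfolding diagonal_def merged_0 by blast
  moreover have "(\<lambda>i. all_modes_prod m \<Omega> (matrix_power (parent_matrix a) i) js) sums ?C js" for js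
  proof (cases "length js = m")
    case True
    \<comment> \<open>\<open>X i\<close> is the entry of the cumulant after contraction of all modes
      with the \<open>i\<close>th power. The \<open>i\<close>th summand is
      \<open>X i - X (Suc i)\<close>.\<close>
    define X where "X i = prod_list (map (path_weight a i) js) * ?C (map (pa ^^ i) js)" for i
    have "all_modes_prod m \<Omega> (matrix_power (parent_matrix a) i) js = X i - X (Suc i)" for i
      unfolding all_modes_prod_parent[OF True] X_def prod_list_path_weight_Suc'
      by (simp add: \<Omega>_def True comp_def algebra_simps)
    moreover have "X \<longlonglongrightarrow> 0"
    proof -
      have "(\<lambda>i. prod_list (map (path_weight a i) ks)) \<longlonglongrightarrow> prod_list (map (\<lambda>_. 0) ks)" for ks
        by (induction ks) (simp_all only: list.map prod_list.Nil prod_list.Cons tendsto_const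
            tendsto_mult path_weight_tendsto_0[of a, OF assms(1)])
      \<comment> \<open>The order is positive, so the limit is a nonempty product of zeros.\<close>
      from this[of js] have "(\<lambda>i. prod_list (map (path_weight a i) js)) \<longlonglongrightarrow> 0"
        using True assms(2) by (cases js) auto
      moreover have "(\<lambda>i. ?C (map (pa ^^ i) js)) \<longlonglongrightarrow> ?C (map (\<lambda>_. r) js)"
      proof (rule tendsto_eventually)
        have "map (pa ^^ i) js = map (\<lambda>_. r) js" if "i \<ge> (\<Sum>j\<in>UNIV. lev j)" for i
        proof (intro map_cong refl)
          fix j
          have "lev j \<le> i"
            using member_le_sum[of j UNIV lev] that by simp
          then show "(pa ^^ i) j = r"
            by (simp add: funpow_eq_root_iff)
        qed
        then show "\<forall>\<^sub>F i in sequentially. ?C (map (pa ^^ i) js) = ?C (map (\<lambda>_. r) js)"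
          by (intro eventually_sequentiallyI[of "\<Sum>j\<in>UNIV. lev j"]) (simp only:)
      qed
      ultimately have "X \<longlonglongrightarrow> 0 * ?C (map (\<lambda>_. r) js)"
        unfolding X_def[abs_def] by (rule tendsto_mult)
      then show ?thesis
        by simp
    qed
    then have "(\<lambda>i. X i - X (Suc i)) sums (X 0 - 0)"
      by (rule telescope_sums')
    moreover have "prod_list (map (path_weight a 0) js) = 1"
      by (induction js) simp_all
    then have "X 0 = ?C js"
      by (simp add: X_def)
    ultimately show ?thesis
      by simp
  next
    case False
    then show ?thesis
      using all_modes_prod_wrong_length[OF len False] by (simp add: cumulant_def)
  qed
  ultimately show ?thesis
    by blast
qed

text \<open>
  Off the diagonal the series satisfies \<open>T = T \<times>\<^sub>1 A \<dots> \<times>\<^sub>m A\<close>, so every entry is a multiple of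
  the diagonal entry at the vertex where the ancestors of its indices meet.
\<close>

lemma lyapunov_sums_imp_cumulant:
  assumes sym: "T \<in> sym_tensors m" and diag: "diagonal \<Omega>"
    and sums: "\<And>js. (\<lambda>i. all_modes_prod m \<Omega> (matrix_power (parent_matrix a) i) js) sums T js"
  shows "T = cumulant a (\<lambda>_ k. T (replicate m k)) m"
proof
  fix js
  have zero: "T js = 0" if "length js \<noteq> m" for js
    using sym that unfolding sym_tensors_def by blast
  have step: "T js = prod_list (map a js) * T (map pa js)"
    if "length js = m" "\<not> merged 0 (set js)" for js
  proof -
    let ?f = "\<lambda>js i. \<Omega> (map (pa ^^ i) js) * prod_list (map (path_weight a i) js)"
    have f: "?f ks sums T ks" if "length ks = m" for ks
      using sums[of ks] that by (simp add: all_modes_prod_parent)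
    have "(\<lambda>i. prod_list (map a js) * ?f (map pa js) i) sums (prod_list (map a js) * T (map pa js))"
      by (intro sums_mult f) (simp add: that)
    also have "(\<lambda>i. prod_list (map a js) * ?f (map pa js) i) = (\<lambda>i. ?f js (Suc i))"
      unfolding prod_list_path_weight_Suc by (simp add: comp_def funpow_swap1 mult_ac)
    \<comment> \<open>The initial term is an entry of the noise tensor off the diagonal, hence 0,
      and the shifted series alone has the sum \<open>T js\<close>.\<close>
    finally have "?f js sums (prod_list (map a js) * T (map pa js) + ?f js 0)"
      by (rule sums_Suc[of "?f js"])
    moreover have "\<Omega> js = 0"
      using diag that(2) unfolding diagonal_def merged_0 by blast
    then have "?f js 0 = 0"
      by simp
    ultimately have "?f js sums (prod_list (map a js) * T (map pa js))"
      by (simp only: add_0_right)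
    then show ?thesis
      by (rule sums_unique2[OF f[OF that(1)]])
  qed
  have "T js = T (replicate m (meet (set js))) * prod_list (map (path_weight a (merge_time (set js))) js)"
    if "length js = m" for js
    using that
  proof (induction "merge_time (set js)" arbitrary: js)
    case 0
    then have "(pa ^^ 0) j = meet (set js)" if "j \<in> set js" for j
      using meet_eq[OF that] by (simp only:)
    then have "js = replicate m (meet (set js))"
      using \<open>length js = m\<close> by (intro replicate_eqI) auto
    then show ?case
      unfolding \<open>0 = merge_time (set js)\<close>[symmetric] by (simp add: comp_def map_replicate_const)
  next
    case (Suc d)
    then have nm: "\<not> merged 0 (set js)"
      by (simp add: merged_iff flip: Suc.hyps(2))
    then have "merge_time (set (map pa js)) = d" and meet: "meet (set (map pa js)) = meet (set js)"
      using merge_time_parent[OF nm] meet_parent[OF nm] Suc.hyps(2) by simp_all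
    then have "T (map pa js) = T (replicate m (meet (set js))) * prod_list (map (path_weight a d) (map pa js))"
      using Suc.hyps(1)[of "map pa js"] Suc.prems by (simp only: length_map)
    then show ?case
      unfolding Suc.hyps(2)[symmetric] prod_list_path_weight_Suc
      using step[OF Suc.prems nm] by simp
  qed
  from this[of js] show "T js = cumulant a (\<lambda>_ k. T (replicate m k)) m js"
    using zero[of js] by (cases "length js = m") (simp_all add: cumulant_def)
qed

end

context parent_graph
begin

lemma stable_matrices_eq: "stable_matrices G = {parent_matrix a | a. \<bar>a r\<bar> < 1}"
proof (intro set_eqI iffI)
  fix A assume A: "A \<in> stable_matrices G"
  define a where "a j = A $ j $ pa j" for j
  have "A = parent_matrix a"
    using A by (auto simp: stable_matrices_def arc_iff vec_eq_iff a_def)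
  moreover have "\<bar>a r\<bar> < 1"
  proof (cases "a r = 0")
    case False
    then have "norm (complex_of_real (a r)) < 1"
      using A root_weight_eigenvalue[of a] False calculation by (auto simp: stable_matrices_def)
    then show ?thesis
      by simp
  qed simp
  ultimately show "A \<in> {parent_matrix a | a. \<bar>a r\<bar> < 1}"
    by blast
next
  fix A assume "A \<in> {parent_matrix a | a. \<bar>a r\<bar> < 1}"
  then show "A \<in> stable_matrices G"
    using eigenvalue_norm_less_1 by (auto simp: stable_matrices_def arc_iff)
qed

lemma cumulant_model_eq:
  "cumulant_model n G = {\<lambda>m\<in>{2..n}. cumulant a t m | a t. \<bar>a r\<bar> < 1}"
proof (intro set_eqI iffI)
  fix T assume "T \<in> cumulant_model n G"
  then obtain a \<Omega> where T: "T \<in> (\<Pi>\<^sub>E m\<in>{2..n}. sym_tensors m)" and "\<bar>a r\<bar> < 1"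
    and *: "\<And>m. m \<in> {2..n} \<Longrightarrow> diagonal (\<Omega> m) \<and>
      (\<forall>js. (\<lambda>i. all_modes_prod m (\<Omega> m) (matrix_power (parent_matrix a) i) js) sums T m js)"
    unfolding cumulant_model_def stable_matrices_eq by blast
  define t where "t m k = T m (replicate m k)" for m k
  have "T m = cumulant a t m" if m: "m \<in> {2..n}" for m
  proof -
    have "T m = cumulant a (\<lambda>_ k. T m (replicate m k)) m"
      using T *[OF m] m by (intro lyapunov_sums_imp_cumulant[of _ _ "\<Omega> m"]) auto
    also have "\<dots> = cumulant a t m"
      by (intro ext) (simp add: cumulant_def t_def)
    finally show ?thesis .
  qed
  have "T = (\<lambda>m\<in>{2..n}. cumulant a t m)"
  proof (rule ext)
    fix m
    show "T m = (\<lambda>m\<in>{2..n}. cumulant a t m) m"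
      using \<open>\<And>m. m \<in> {2..n} \<Longrightarrow> T m = cumulant a t m\<close> PiE_arb[OF T, of m]
      by (cases "m \<in> {2..n}") auto
  qed
  then show "T \<in> {\<lambda>m\<in>{2..n}. cumulant a t m | a t. \<bar>a r\<bar> < 1}"
    using \<open>\<bar>a r\<bar> < 1\<close> by blast
next
  fix T assume "T \<in> {\<lambda>m\<in>{2..n}. cumulant a t m | a t. \<bar>a r\<bar> < 1}"
  then obtain a t where T: "T = (\<lambda>m\<in>{2..n}. cumulant a t m)" and a: "\<bar>a r\<bar> < 1"
    by blast
  have "\<forall>m\<in>{2..n}. \<exists>\<Omega>. \<Omega> \<in> sym_tensors m \<and> diagonal \<Omega> \<and>
      (\<forall>js. (\<lambda>i. all_modes_prod m \<Omega> (matrix_power (parent_matrix a) i) js) sums T m js)"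
    unfolding T using a by (intro ballI) (simp add: lyapunov_sums_cumulant)
  then have "\<exists>\<Omega>. \<forall>m\<in>{2..n}. \<Omega> m \<in> sym_tensors m \<and> diagonal (\<Omega> m) \<and>
      (\<forall>js. (\<lambda>i. all_modes_prod m (\<Omega> m) (matrix_power (parent_matrix a) i) js) sums T m js)"
    by (rule bchoice)
  moreover have "T \<in> (\<Pi>\<^sub>E m\<in>{2..n}. sym_tensors m)"
    unfolding T by (auto intro: cumulant_sym)
  moreover have "parent_matrix a \<in> stable_matrices G"
    using a unfolding stable_matrices_eq by blast
  ultimately show "T \<in> cumulant_model n G"
    unfolding cumulant_model_def by blast
qed

end

section \<open>Generic points of the model\<close>

lemma mpoly_eval_cong:
  assumes "\<And>x. x \<in> mpoly_vars f \<Longrightarrow> b x = c x"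
  shows "mpoly_eval b f = mpoly_eval c f"
  unfolding mpoly_eval_def
  by (intro sum.cong prod.cong refl arg_cong2[of _ _ _ _ "(*)"] arg_cong2[of _ _ _ _ "(^)"] assms)
    (auto simp: mpoly_vars_def)

lemma isCont_mpoly_eval:
  assumes "\<And>x. isCont (\<lambda>e. b e x) y"
  shows "isCont (\<lambda>e. mpoly_eval (b e) f) y"
  unfolding mpoly_eval_def by (intro continuous_intros assms)

lemma isCont_prod_mset:
  fixes g :: "real \<Rightarrow> 'a \<Rightarrow> real"
  assumes "\<And>x. isCont (\<lambda>e. g e x) y"
  shows "isCont (\<lambda>e. \<Prod>x\<in>#M. g e x) y"
  by (induction M) (auto intro!: continuous_intros assms)

lemma prod_mset_divide_const:
  "(\<Prod>x\<in>#M. f x / c) = (\<Prod>x\<in>#M. f x) / (c :: real) ^ size M"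
  by (induction M) simp_all

context parent_map
begin

definition entry :: "('v \<Rightarrow> real) \<Rightarrow> (nat \<Rightarrow> 'v \<Rightarrow> real) \<Rightarrow> 'v multiset \<Rightarrow> real" where
  "entry a t M =
     t (size M) (meet (set_mset M)) * (\<Prod>j\<in>#M. path_weight a (merge_time (set_mset M)) j)"

text \<open>The subtraction is truncated: a walk only passes through the loop once it is above the root.\<close>

definition generic_entry ::
  "real \<Rightarrow> ('v \<Rightarrow> real) \<Rightarrow> (nat \<Rightarrow> 'v \<Rightarrow> real) \<Rightarrow> 'v multiset \<Rightarrow> real" where
  "generic_entry \<rho> w s M =
     s (size M) (meet (set_mset M)) * (\<Prod>j\<in>#M. \<rho> ^ (merge_time (set_mset M) - lev j) * w j)"

text \<open>Off the root the weights are quotients, so that products along walks telescope.\<close>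

definition generic_weight :: "real \<Rightarrow> ('v \<Rightarrow> real) \<Rightarrow> 'v \<Rightarrow> real" where
  "generic_weight \<rho> w j = (if j = r then \<rho> else w j / w (pa j))"

lemma sym_entry_cumulant:
  assumes "size M \<in> {2..n}"
  shows "sym_entry (\<lambda>m\<in>{2..n}. cumulant a t m) M = entry a t M"
proof -
  define js where "js = (SOME js. mset js = M)"
  have "mset js = M"
    unfolding js_def by (rule someI_ex) (rule ex_mset)
  then have "length js = size M" "set js = set_mset M"
    by auto
  then show ?thesis
    using assms \<open>mset js = M\<close>
    by (simp add: sym_entry_def entry_def cumulant_def prod_list_map_mset flip: js_def)
qed

lemma path_weight_generic:
  assumes "\<And>j. w j \<noteq> 0"
  shows "path_weight (generic_weight \<rho> w) d j = \<rho> ^ (d - lev j) * w j / w ((pa ^^ d) j)"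
proof (induction d arbitrary: j)
  case (Suc d)
  show ?case
  proof (cases "j = r")
    case False
    then have "d - lev (pa j) = Suc d - lev j"
      by (simp add: lev_Suc)
    moreover have "generic_weight \<rho> w j = w j / w (pa j)"
      using False by (simp add: generic_weight_def)
    ultimately show ?thesis
      using assms by (simp add: Suc funpow_swap1)
  next
    case True
    have "generic_weight \<rho> w r = \<rho>"
      by (simp add: generic_weight_def)
    then show ?thesis
      using Suc[of r] assms by (simp add: True)
  qed
qed (simp add: assms)

text \<open>The denominators left by telescoping depend only on the meeting point and the order.
  Rescaling the diagonal parameters by \<open>w k ^ m\<close> absorbs them.\<close>

lemma entry_generic:
  assumes "\<And>j. w j \<noteq> 0"
  shows "entry (generic_weight \<rho> w) (\<lambda>m k. s m k * w k ^ m) M = generic_entry \<rho> w s M"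
proof -
  let ?d = "merge_time (set_mset M)" and ?k = "meet (set_mset M)"
  have "image_mset (path_weight (generic_weight \<rho> w) ?d) M =
      image_mset (\<lambda>j. \<rho> ^ (?d - lev j) * w j / w ?k) M"
    by (intro image_mset_cong) (simp add: path_weight_generic assms meet_eq)
  then have "(\<Prod>j\<in>#M. path_weight (generic_weight \<rho> w) ?d j) =
      (\<Prod>j\<in>#M. \<rho> ^ (?d - lev j) * w j) / w ?k ^ size M"
    by (simp only: prod_mset_divide_const)
  then show ?thesis
    using assms by (simp add: entry_def generic_entry_def)
qed

text \<open>Conversely, nonvanishing weights off the root are generic weights, with
  \<open>w j\<close> the weight of the walk from the root down to \<open>j\<close>.\<close>

lemma generic_weight_path_weight:
  assumes "\<And>j. j \<noteq> r \<Longrightarrow> a j \<noteq> 0"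
  shows "path_weight a (lev j) j \<noteq> 0"
    and "generic_weight (a r) (\<lambda>j. path_weight a (lev j) j) j = a j"
proof -
  have step: "path_weight a (lev i) i = a i * path_weight a (lev (pa i)) (pa i)" if "i \<noteq> r" for i
    by (simp add: lev_Suc[OF that])
  have ne: "path_weight a (lev j) j \<noteq> 0" for j
  proof (induction "lev j" arbitrary: j)
    case (Suc l)
    then have "j \<noteq> r"
      by auto
    then show ?case
      using step[of j] assms[of j] Suc.hyps(1)[of "pa j"] Suc.hyps(2) lev_Suc[of j] by simp
  qed simp
  show "path_weight a (lev j) j \<noteq> 0"
    by (rule ne)
  show "generic_weight (a r) (\<lambda>j. path_weight a (lev j) j) j = a j"
    using step[of j] ne[of "pa j"] by (simp add: generic_weight_def)
qed

lemma isCont_path_weight: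
  fixes b :: "real \<Rightarrow> 'v \<Rightarrow> real"
  assumes "\<And>j. isCont (\<lambda>e. b e j) y"
  shows "isCont (\<lambda>e. path_weight (b e) d j) y"
  by (induction d arbitrary: j) (auto intro!: continuous_intros assms)

text \<open>Density of the generic points: replace the vanishing edge weights by \<open>e\<close>
  and let \<open>e\<close> tend to 0. The loop weight is left alone, so its bound is
  preserved.\<close>

lemma mpoly_eval_entry_zero_if_generic:
  assumes gen: "\<And>\<rho> w s. \<bar>\<rho>\<bar> < 1 \<Longrightarrow> (\<And>j. w j \<noteq> 0) \<Longrightarrow> w r = 1 \<Longrightarrow>
      mpoly_eval (generic_entry \<rho> w s) f = 0"
    and "\<bar>a r\<bar> < 1"
  shows "mpoly_eval (entry a t) f = 0"
proof -
  define b where "b e j = (if j \<noteq> r \<and> a j = 0 then e else a j)" for e j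
  let ?F = "\<lambda>e. mpoly_eval (entry (b e) t) f"
  have "?F e = 0" if "e \<noteq> 0" for e
  proof -
    have nz: "b e j \<noteq> 0" if "j \<noteq> r" for j
      using that \<open>e \<noteq> 0\<close> by (simp add: b_def)
    define w where "w j = path_weight (b e) (lev j) j" for j
    have w: "w j \<noteq> 0" for j
      unfolding w_def using nz by (rule generic_weight_path_weight)
    have "generic_weight (b e r) w = b e"
      unfolding w_def[abs_def] using generic_weight_path_weight(2)[of "b e"] nz by blast
    then have "entry (b e) t M = generic_entry (b e r) w (\<lambda>m k. t m k / w k ^ m) M" for M
      using entry_generic[of w "b e r" "\<lambda>m k. t m k / w k ^ m" M] w by simp
    then have "entry (b e) t = generic_entry (b e r) w (\<lambda>m k. t m k / w k ^ m)"
      by blast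
    then show ?thesis
      using gen[of "b e r" w "\<lambda>m k. t m k / w k ^ m"] w assms(2) by (simp add: b_def w_def)
  qed
  then have "\<forall>\<^sub>F e in at 0. ?F e = 0"
    by (simp add: eventually_at_filter)
  then have "(?F \<longlongrightarrow> 0) (at 0)"
    by (rule tendsto_eventually)
  moreover have "isCont ?F 0"
    unfolding entry_def
  proof (intro isCont_mpoly_eval continuous_intros isCont_prod_mset isCont_path_weight)
    have "isCont (\<lambda>e. if P then e else c) 0" for P and c :: real
      by (cases P) simp_all
    then show "isCont (\<lambda>e. b e j) 0" for j
      unfolding b_def .
  qed
  then have "(?F \<longlongrightarrow> ?F 0) (at 0)"
    by (rule isContD)
  ultimately have "?F 0 = 0"
    using tendsto_unique[OF trivial_limit_at] by blast
  moreover have "b 0 = a"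
    by (rule ext) (simp add: b_def)
  ultimately show ?thesis
    by simp
qed

end

lemma (in parent_graph) cumulant_ideal_iff:
  "f \<in> cumulant_ideal n G \<longleftrightarrow> mpoly_vars f \<subseteq> {M. size M \<in> {2..n}} \<and>
     (\<forall>\<rho> w s. \<bar>\<rho>\<bar> < 1 \<longrightarrow> (\<forall>j. w j \<noteq> 0) \<longrightarrow> w r = 1 \<longrightarrow> mpoly_eval (generic_entry \<rho> w s) f = 0)"
proof (cases "mpoly_vars f \<subseteq> {M. size M \<in> {2..n}}")
  case True
  have "mpoly_eval (sym_entry (\<lambda>m\<in>{2..n}. cumulant a t m)) f = mpoly_eval (entry a t) f" for a t
    by (rule mpoly_eval_cong) (use True sym_entry_cumulant in blast)
  moreover have "f \<in> cumulant_ideal n G \<longleftrightarrow> (\<forall>a t. \<bar>a r\<bar> < 1 \<longrightarrow>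
      mpoly_eval (sym_entry (\<lambda>m\<in>{2..n}. cumulant a t m)) f = 0)"
    using True unfolding cumulant_ideal_def cumulant_model_eq by blast
  ultimately have "f \<in> cumulant_ideal n G \<longleftrightarrow>
      (\<forall>a t. \<bar>a r\<bar> < 1 \<longrightarrow> mpoly_eval (entry a t) f = 0)"
    by (simp only:)
  also have "\<dots> \<longleftrightarrow> (\<forall>\<rho> w s. \<bar>\<rho>\<bar> < 1 \<longrightarrow> (\<forall>j. w j \<noteq> 0) \<longrightarrow> w r = 1 \<longrightarrow>
      mpoly_eval (generic_entry \<rho> w s) f = 0)"
  proof (intro iffI allI impI)
    fix \<rho> :: real and w :: "'v \<Rightarrow> real" and s
    assume *: "\<forall>a t. \<bar>a r\<bar> < 1 \<longrightarrow> mpoly_eval (entry a t) f = 0"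
      and "\<bar>\<rho>\<bar> < 1" "\<forall>j. w j \<noteq> 0"
    then have "generic_entry \<rho> w s = entry (generic_weight \<rho> w) (\<lambda>m k. s m k * w k ^ m)"
      using entry_generic[of w \<rho> s] by (intro ext) simp
    moreover have "\<bar>generic_weight \<rho> w r\<bar> < 1"
      using \<open>\<bar>\<rho>\<bar> < 1\<close> by (simp add: generic_weight_def)
    ultimately show "mpoly_eval (generic_entry \<rho> w s) f = 0"
      using * by simp
  next
    fix a :: "'v \<Rightarrow> real" and t
    assume "\<forall>\<rho> w s. \<bar>\<rho>\<bar> < 1 \<longrightarrow> (\<forall>j. w j \<noteq> 0) \<longrightarrow> w r = 1 \<longrightarrow>
      mpoly_eval (generic_entry \<rho> w s) f = 0" and "\<bar>a r\<bar> < 1"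
    then show "mpoly_eval (entry a t) f = 0"
      by (intro mpoly_eval_entry_zero_if_generic) blast+
  qed
  finally show ?thesis
    using True by blast
qed (simp add: cumulant_ideal_def)

section \<open>Binomials\<close>

definition monom_of :: "'x list \<Rightarrow> 'x \<Rightarrow>\<^sub>0 nat" where
  "monom_of xs = (\<Sum>x\<leftarrow>xs. Poly_Mapping.single x 1)"

definition binomial_poly :: "'x list \<Rightarrow> 'x list \<Rightarrow> 'x real_mpoly" where
  "binomial_poly xs ys = Poly_Mapping.single (monom_of xs) 1 - Poly_Mapping.single (monom_of ys) 1"

lemma keys_monom_of: "Poly_Mapping.keys (monom_of xs) \<subseteq> set xs"
proof (induction xs)
  case (Cons x xs)
  then show ?case
    using keys_add[of "Poly_Mapping.single x 1" "monom_of xs"] by (auto simp: monom_of_def)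
qed (simp add: monom_of_def)

lemma eval_monom_of:
  "(\<Prod>x\<in>Poly_Mapping.keys (monom_of xs). b x ^ Poly_Mapping.lookup (monom_of xs) x) =
    prod_list (map b xs :: real list)"
proof (induction xs)
  case (Cons x xs)
  let ?K = "insert x (Poly_Mapping.keys (monom_of xs))"
  have eq: "monom_of (x # xs) = Poly_Mapping.single x 1 + monom_of xs"
    by (simp add: monom_of_def)
  have "(\<Prod>y\<in>Poly_Mapping.keys (monom_of (x # xs)). b y ^ Poly_Mapping.lookup (monom_of (x # xs)) y) =
      (\<Prod>y\<in>?K. b y ^ Poly_Mapping.lookup (monom_of (x # xs)) y)"
    by (intro prod.mono_neutral_left)
      (use keys_add[of "Poly_Mapping.single x 1" "monom_of xs"] in \<open>auto simp: eq in_keys_iff\<close>)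
  also have "\<dots> = (\<Prod>y\<in>?K. b y ^ Poly_Mapping.lookup (Poly_Mapping.single x 1) y) *
      (\<Prod>y\<in>?K. b y ^ Poly_Mapping.lookup (monom_of xs) y)"
    by (simp add: eq lookup_add power_add prod.distrib)
  also have "(\<Prod>y\<in>?K. b y ^ Poly_Mapping.lookup (Poly_Mapping.single x 1) y) =
      (\<Prod>y\<in>{x}. b y ^ Poly_Mapping.lookup (Poly_Mapping.single x 1) y)"
    by (intro prod.mono_neutral_right) (auto simp: lookup_single when_def split: if_splits)
  also have "(\<Prod>y\<in>?K. b y ^ Poly_Mapping.lookup (monom_of xs) y) =
      (\<Prod>y\<in>Poly_Mapping.keys (monom_of xs). b y ^ Poly_Mapping.lookup (monom_of xs) y)"
    by (intro prod.mono_neutral_right) (auto simp: in_keys_iff)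
  finally show ?case
    by (simp add: Cons)
qed (simp add: monom_of_def)

lemma keys_binomial_poly: "Poly_Mapping.keys (binomial_poly xs ys) \<subseteq> {monom_of xs, monom_of ys}"
  using keys_diff[of "Poly_Mapping.single (monom_of xs) (1::real)" "Poly_Mapping.single (monom_of ys) 1"]
  by (auto simp: binomial_poly_def)

lemma mpoly_vars_binomial_poly: "mpoly_vars (binomial_poly xs ys) \<subseteq> set xs \<union> set ys"
  using keys_binomial_poly[of xs ys] keys_monom_of[of xs] keys_monom_of[of ys]
  unfolding mpoly_vars_def by blast

lemma mpoly_eval_binomial_poly:
  "mpoly_eval b (binomial_poly xs ys) = prod_list (map b xs) - prod_list (map b ys)"
proof (cases "monom_of xs = monom_of ys")
  case True
  then show ?thesis
    using eval_monom_of[of b xs] eval_monom_of[of b ys] by (simp add: mpoly_eval_def binomial_poly_def)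
next
  case False
  let ?f = "binomial_poly xs ys"
  let ?e = "\<lambda>mon. \<Prod>x\<in>Poly_Mapping.keys mon. b x ^ Poly_Mapping.lookup mon x"
  have "mpoly_eval b ?f = (\<Sum>mon\<in>{monom_of xs, monom_of ys}. Poly_Mapping.lookup ?f mon * ?e mon)"
    unfolding mpoly_eval_def
    by (intro sum.mono_neutral_left keys_binomial_poly) (auto simp: in_keys_iff)
  also have "\<dots> = ?e (monom_of xs) - ?e (monom_of ys)"
    using False by (simp add: binomial_poly_def lookup_minus lookup_single)
  finally show ?thesis
    by (simp only: eval_monom_of)
qed

text \<open>An identity of monomials at all generic points of one tree puts a binomial into the
  common ideal. It can then be tested on the other tree at \<open>w = 1\<close> and convenient
  \<open>\<rho>\<close> and \<open>s\<close>.\<close>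

lemma binomial_transfer:
  assumes "parent_graph pa r G" and "parent_graph pa' r' H"
    and ideal: "cumulant_ideal n G = cumulant_ideal n H"
    and size: "\<And>M. M \<in> set xs \<union> set ys \<Longrightarrow> size M \<in> {2..n}"
    and eq: "\<And>\<rho> w s. w r = 1 \<Longrightarrow>
      prod_list (map (parent_map.generic_entry pa r \<rho> w s) xs) =
      prod_list (map (parent_map.generic_entry pa r \<rho> w s) ys)"
    and "\<bar>\<rho>\<bar> < 1"
  shows "prod_list (map (parent_map.generic_entry pa' r' \<rho> (\<lambda>_. 1) s) xs) =
    prod_list (map (parent_map.generic_entry pa' r' \<rho> (\<lambda>_. 1) s) ys)"
proof -
  interpret P: parent_graph pa r G by fact
  interpret Q: parent_graph pa' r' H by fact
  have "mpoly_vars (binomial_poly xs ys) \<subseteq> {M. size M \<in> {2..n}}"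
    using mpoly_vars_binomial_poly[of xs ys] size by blast
  then have "binomial_poly xs ys \<in> cumulant_ideal n G"
    unfolding P.cumulant_ideal_iff mpoly_eval_binomial_poly using eq by simp
  then have "mpoly_eval (Q.generic_entry \<rho> (\<lambda>_. 1) s) (binomial_poly xs ys) = 0"
    unfolding ideal Q.cumulant_ideal_iff using \<open>\<bar>\<rho>\<bar> < 1\<close> by simp
  then show ?thesis
    by (simp add: mpoly_eval_binomial_poly)
qed

section \<open>Recovering levels and meeting points from the ideal\<close>

context parent_map
begin

text \<open>The merge time with the root is \<open>lev i\<close>, so each index \<open>r\<close>
  contributes \<open>\<rho> ^ lev i\<close> and each index \<open>i\<close> only
  \<open>w i\<close>.\<close>

lemma generic_entry_root [simp]:
  assumes "w r = 1"
  shows "generic_entry \<rho> w s {#i, r#} = s 2 r * \<rho> ^ lev i * w i"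
    and "generic_entry \<rho> w s {#i, r, r#} = s 3 r * \<rho> ^ (2 * lev i) * w i"
    and "generic_entry \<rho> w s {#i, i, r#} = s 3 r * \<rho> ^ lev i * w i ^ 2"
  using assms
  by (simp_all add: generic_entry_def power2_eq_square mult_2 power_add flip: numeral_2_eq_2)

lemma generic_entry_diagonal [simp]:
  "generic_entry \<rho> w s {#k, k#} = s 2 k * w k ^ 2"
  "generic_entry \<rho> w s {#k, k, k#} = s 3 k * w k ^ 3"
  by (simp_all add: generic_entry_def numeral_2_eq_2 numeral_3_eq_3)

lemma generic_entry_same_level:
  assumes "lev i = lev j"
  shows "generic_entry \<rho> w s {#i, j#} = s 2 (meet {i, j}) * w i * w j"
  using merge_time_pair_same_level[OF assms] assms by (simp add: generic_entry_def numeral_2_eq_2)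

lemma ex_level_1: "j \<noteq> r \<Longrightarrow> \<exists>u. lev u = 1"
  using lev_funpow[of "lev j - 1" j] lev_eq_0_iff[of j] by (intro exI[of _ "(pa ^^ (lev j - 1)) j"]) linarith

end

locale same_ideal = P: parent_graph pa r G + Q: parent_graph pa' r' H
  for pa r and G :: "'v::finite pair_pre_digraph" and pa' r' and H :: "'v pair_pre_digraph" +
  fixes n :: nat
  assumes n: "n \<ge> 3" and ideal: "cumulant_ideal n G = cumulant_ideal n H"
begin

lemmas transfer = binomial_transfer[OF P.parent_graph_axioms Q.parent_graph_axioms ideal]

lemma root_eq: "r = r'"
proof (rule ccontr)
  assume "r \<noteq> r'"
  \<comment> \<open>In the first tree both monomials equal
    \<open>s 2 r ^ 3 * s 3 r ^ 2 * (\<rho> ^ lev r' * w r') ^ 3\<close>. In the second the entry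
    \<open>{#r, r#}\<close> is \<open>s 2 r\<close>; choosing it as 0 kills the right monomial but
    not the left one.\<close>
  define s where "s m k = (if m = 2 \<and> k = r then 0 else 1 :: real)" for m :: nat and k
  let ?xs = "replicate 3 {#r', r#} @ replicate 2 {#r, r, r#}"
    and ?ys = "replicate 3 {#r, r#} @ [{#r', r, r#}, {#r', r', r#}]"
  have "prod_list (map (Q.generic_entry (1/2) (\<lambda>_. 1) s) ?xs) =
      prod_list (map (Q.generic_entry (1/2) (\<lambda>_. 1) s) ?ys)"
  proof (rule transfer)
    fix \<rho> :: real and w s assume "w r = (1::real)"
    then show "prod_list (map (P.generic_entry \<rho> w s) ?xs) = prod_list (map (P.generic_entry \<rho> w s) ?ys)"
      by (simp add: power_mult_distrib power_mult[symmetric] power2_eq_square power3_eq_cube mult_2 power_add mult_ac)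
  qed (use n in auto)
  moreover have "Q.generic_entry (1/2) (\<lambda>_. 1) s {#r', r#} \<noteq> 0"
    using Q.generic_entry_root(1)[of "\<lambda>_. 1" "1/2" s r] \<open>r \<noteq> r'\<close>
    by (simp add: s_def add_mset_commute)
  ultimately show False
    by (simp add: s_def)
qed

lemma lev_proportional: "Q.lev i * P.lev j = Q.lev j * P.lev i"
proof -
  \<comment> \<open>Since \<open>\<rho> ^ lev i\<close> is
    \<open>{#i, r, r#} {#r, r#} / ({#i, r#} {#r, r, r#})\<close>, this binomial clears denominators
    in the identity of its power \<open>P.lev j\<close> with the power \<open>P.lev i\<close> of the
    quotient for \<open>j\<close>. The exponents stay those of the first tree when the second is
    inserted.\<close>
  let ?xs = "replicate (P.lev j) {#i, r, r#} @ replicate (P.lev j) {#r, r#} @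
      replicate (P.lev i) {#j, r#} @ replicate (P.lev i) {#r, r, r#}"
    and ?ys = "replicate (P.lev j) {#i, r#} @ replicate (P.lev j) {#r, r, r#} @
      replicate (P.lev i) {#j, r, r#} @ replicate (P.lev i) {#r, r#}"
  have "prod_list (map (Q.generic_entry (1/2) (\<lambda>_. 1) (\<lambda>_ _. 1)) ?xs) =
      prod_list (map (Q.generic_entry (1/2) (\<lambda>_. 1) (\<lambda>_ _. 1)) ?ys)"
  proof (rule transfer)
    fix \<rho> :: real and w s assume "w r = (1::real)"
    then show "prod_list (map (P.generic_entry \<rho> w s) ?xs) = prod_list (map (P.generic_entry \<rho> w s) ?ys)"
      by (simp add: power_mult_distrib power_mult[symmetric] mult_ac)
  qed (use n in \<open>auto split: if_splits\<close>)
  then have "(1/2::real) ^ (2 * Q.lev i * P.lev j + Q.lev j * P.lev i) =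
      (1/2) ^ (Q.lev i * P.lev j + 2 * Q.lev j * P.lev i)"
    by (simp add: root_eq power_mult[symmetric] power_add)
  then have "2 * Q.lev i * P.lev j + Q.lev j * P.lev i = Q.lev i * P.lev j + 2 * Q.lev j * P.lev i"
    by (simp only: power_one_over) simp
  then show ?thesis
    by (simp add: mult.commute)
qed

text \<open>Both level functions take the value 1 unless the root is the only vertex; this fixes the
  factor of proportionality.\<close>

lemma lev_eq: "P.lev i = Q.lev i"
proof (cases "i = r")
  case False
  obtain u where u: "P.lev u = 1"
    using P.ex_level_1 False by blast
  obtain v where v: "Q.lev v = 1"
    using Q.ex_level_1 False root_eq by blast
  have "Q.lev u = 1"
    using lev_proportional[of v u] u v by simp
  then show ?thesis
    using lev_proportional[of i u] u by simp
qed (metis P.lev_root Q.lev_root root_eq)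

lemma meet_eq: "P.meet {i, j} = Q.meet {i, j}"
proof (cases "P.lev i = P.lev j")
  case False
  then have "P.meet {i, j} = r" "Q.meet {i, j} = r'"
    by (auto intro: P.meet_pair_different_level Q.meet_pair_different_level simp: lev_eq)
  then show ?thesis
    using root_eq by simp
next
  case True
  define k where "k = P.meet {i, j}"
  \<comment> \<open>The value 2 singles out \<open>k\<close> among the possible meeting points in
    the second tree.\<close>
  define s where "s m l = (if l = k then 2 else 1 :: real)" for m :: nat and l
  \<comment> \<open>For equal levels \<open>{#i, j#} / {#k, k#}\<close> is
    \<open>w i * w j / w k ^ 2\<close>. Each \<open>w\<close> is
    \<open>{#i, r#} ^ 2 / {#i, r, r#}\<close> up to a common factor, which cancels in this
    quotient.\<close>
  let ?xs = "{#i, j#} # replicate 4 {#k, r#} @ [{#i, r, r#}, {#j, r, r#}]"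
    and ?ys = "{#k, k#} # replicate 2 {#i, r#} @ replicate 2 {#j, r#} @ replicate 2 {#k, r, r#}"
  have "prod_list (map (Q.generic_entry (1/2) (\<lambda>_. 1) s) ?xs) =
      prod_list (map (Q.generic_entry (1/2) (\<lambda>_. 1) s) ?ys)"
  proof (rule transfer)
    fix \<rho> :: real and w s assume "w r = (1::real)"
    then show "prod_list (map (P.generic_entry \<rho> w s) ?xs) = prod_list (map (P.generic_entry \<rho> w s) ?ys)"
      using P.generic_entry_same_level[OF True]
      by (simp add: k_def[symmetric] power_mult_distrib power_mult[symmetric] mult_ac eval_nat_numeral power_add)
  qed (use n in auto)
  moreover have "Q.lev i = Q.lev j"
    using True by (simp add: lev_eq)
  moreover have "s 2 r' \<noteq> 0" "s 3 r' \<noteq> 0"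
    by (simp_all add: s_def)
  ultimately have "s 2 (Q.meet {i, j}) = s 2 k"
    by (simp add: Q.generic_entry_same_level root_eq power_mult_distrib power_mult[symmetric] power_add
        mult_ac eval_nat_numeral)
  then show ?thesis
    by (simp add: s_def k_def split: if_splits)
qed

end

theorem theorem6p6:
  fixes G H :: "'v::finite pair_pre_digraph" and n :: nat
  assumes "n \<ge> 3"
    and "pverts G = UNIV" and "pverts H = UNIV"
    and "source_looped_tree G" and "source_looped_tree H"
  shows "cumulant_ideal n G = cumulant_ideal n H \<longleftrightarrow>
           (\<forall>l. level_set G l = level_set H l) \<and>
           (\<forall>i j. shortest_equitrek_tops G i j = shortest_equitrek_tops H i j)"
proof -
  obtain pa r pa' r' where "parent_graph pa r G" "parent_graph pa' r' H"
    using source_looped_tree_parent_graph[of G] source_looped_tree_parent_graph[of H] assms by auto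
  then interpret P: parent_graph pa r G + Q: parent_graph pa' r' H
    by blast+
  have "(\<forall>l. level_set G l = level_set H l) \<longleftrightarrow> (\<forall>i. P.lev i = Q.lev i)"
    unfolding level_set_def P.pverts_UNIV Q.pverts_UNIV P.level_eq Q.level_eq by (auto simp: set_eq_iff)
  moreover have "(\<forall>i j. shortest_equitrek_tops G i j = shortest_equitrek_tops H i j) \<longleftrightarrow>
      (\<forall>i j. P.meet {i, j} = Q.meet {i, j})"
    by (simp add: P.shortest_equitrek_tops_eq Q.shortest_equitrek_tops_eq)
  moreover have "cumulant_ideal n G = cumulant_ideal n H"
    if lev: "\<And>i. P.lev i = Q.lev i" and meet: "\<And>i j. P.meet {i, j} = Q.meet {i, j}"
  proof -
    have "r = r'"
      using lev[of r] Q.lev_eq_0_iff[of r] by simp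
    have "P.generic_entry \<rho> w s M = Q.generic_entry \<rho> w s M" if "size M \<in> {2..n}" for \<rho> w s M
    proof -
      \<comment> \<open>Orders start at 2, so the passage from pairs to sets applies to every
        variable.\<close>
      have "set_mset M \<noteq> {}"
        using that by auto
      then show ?thesis
        using P.merge_time_meet_cong[OF Q.parent_map_axioms lev meet]
        by (simp add: P.generic_entry_def Q.generic_entry_def lev)
    qed
    then have "mpoly_eval (P.generic_entry \<rho> w s) f = mpoly_eval (Q.generic_entry \<rho> w s) f"
      if "mpoly_vars f \<subseteq> {M. size M \<in> {2..n}}" for \<rho> w s f
      by (intro mpoly_eval_cong) (use that in blast)
    then show ?thesis
      unfolding set_eq_iff P.cumulant_ideal_iff Q.cumulant_ideal_iff \<open>r = r'\<close>
      by metis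
  qed
  moreover have "(\<forall>i. P.lev i = Q.lev i) \<and> (\<forall>i j. P.meet {i, j} = Q.meet {i, j})"
    if "cumulant_ideal n G = cumulant_ideal n H"
  proof -
    interpret same_ideal pa r G pa' r' H n
      by (unfold_locales, rule assms(1), rule that)
    show ?thesis
      using lev_eq meet_eq by blast
  qed
  ultimately show ?thesis
    by blast
qed

end
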